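(* For $n\ge 0$ let $A(n)$ be the number of integers $k\ge 0$ such that $\lfloor k(\sqrt2-1)\rfloor=n$, and let $B(n)=\lfloor(n+1)(\sqrt2+1)\rfloor-\lfloor n(\sqrt2+1)\rfloor$. Then $A(n)=B(n)$ for all $n\ge 1$.
   Context: $A(n)$ is OEIS sequence A097509 and $B(n)$ is OEIS sequence A276862 (the first difference of A003151, $\lfloor n(\sqrt2+1)\rfloor$). *)

theory Defs
  imports Complex_Main
begin

(* OEIS A097509. The set is finite, since k * (sqrt 2 - 1) is unbounded, so the
   convention that card is 0 on infinite sets plays no role. *)
definition A :: "nat \<Rightarrow> nat" where
  "A n = card {k::nat. \<lfloor>real k * (sqrt 2 - 1)\<rfloor> = int n}"

(* OEIS A276862, indexed from n = 0: first difference of the Beatty sequence A003151. *)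
definition B :: "nat \<Rightarrow> int" where
  "B n = \<lfloor>(real n + 1) * (sqrt 2 + 1)\<rfloor> - \<lfloor>real n * (sqrt 2 + 1)\<rfloor>"

end

theory Submission
  imports Defs "HOL-Computational_Algebra.Primes"
begin

text \<open>Since \<open>(sqrt 2 - 1) * (sqrt 2 + 1) = 1\<close>, the condition \<open>\<lfloor>k (sqrt 2 - 1)\<rfloor> = n\<close> says that
  \<open>n s \<le> k < (n + 1) s\<close> for \<open>s = sqrt 2 + 1\<close>. As \<open>s\<close> is irrational, for \<open>n \<ge> 1\<close> neither end point
  is an integer, so these \<open>k\<close> are the integers in \<open>(\<lfloor>n s\<rfloor>, \<lfloor>(n + 1) s\<rfloor>]\<close>.\<close>

text \<open>The exponent of 2 is even in a nonzero square but odd in twice a nonzero square.\<close>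

lemma square_neq_twice_square:
  fixes a b :: nat
  assumes "b \<noteq> 0"
  shows "a\<^sup>2 \<noteq> 2 * b\<^sup>2"
proof
  assume eq: "a\<^sup>2 = 2 * b\<^sup>2"
  with assms have "a \<noteq> 0" by (cases "a = 0") auto
  then have "even (multiplicity 2 (a\<^sup>2))"
    by (simp add: prime_elem_multiplicity_power_distrib)
  moreover have "odd (multiplicity 2 (2 * b\<^sup>2))"
    using assms by (simp add: prime_elem_multiplicity_mult_distrib prime_elem_multiplicity_power_distrib)
  ultimately show False using eq by simp
qed

lemma mult_sqrt2_plus_1_neq_of_nat:
  fixes m k :: nat
  assumes "m \<ge> 1"
  shows "real m * (sqrt 2 + 1) \<noteq> real k"
proof
  assume eq: "real m * (sqrt 2 + 1) = real k"
  then have *: "real m * sqrt 2 = real k - real m" by (simp add: algebra_simps)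
  have "real m * sqrt 2 \<ge> 0" by simp
  \<comment> \<open>This keeps the natural subtraction \<open>k - m\<close> from truncating, so its
    square can be compared with \<open>2 * m\<^sup>2\<close>.\<close>
  then have "m \<le> k" using * by linarith
  then have "real (k - m) = real m * sqrt 2" using * by (simp add: of_nat_diff)
  then have "real ((k - m)\<^sup>2) = real (2 * m\<^sup>2)" by (simp add: power_mult_distrib)
  then have "(k - m)\<^sup>2 = 2 * m\<^sup>2" by (simp only: of_nat_eq_iff)
  then show False using square_neq_twice_square[of m "k - m"] assms by simp
qed

lemma floor_mult_sqrt2_minus_1_eq_iff:
  fixes n k :: nat
  shows "\<lfloor>real k * (sqrt 2 - 1)\<rfloor> = int n \<longleftrightarrow>
    real n * (sqrt 2 + 1) \<le> real k \<and> real k < (real n + 1) * (sqrt 2 + 1)"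
proof -
  have s: "sqrt 2 + 1 > (0::real)" by (simp add: add_pos_pos)
  have "real k * (sqrt 2 - 1) = real k / (sqrt 2 + 1)"
    using s by (simp add: field_simps)
  then show ?thesis
    using s by (simp add: floor_eq_iff pos_le_divide_eq pos_divide_less_eq)
qed

theorem mainTheorem9:
  fixes n :: nat
  assumes "n \<ge> 1"
  shows "int (A n) = B n"
proof -
  let ?s = "sqrt 2 + 1 :: real"
  define a b where "a = nat \<lfloor>real n * ?s\<rfloor>" and "b = nat \<lfloor>(real n + 1) * ?s\<rfloor>"
  have a: "int a = \<lfloor>real n * ?s\<rfloor>" and b: "int b = \<lfloor>(real n + 1) * ?s\<rfloor>"
    by (simp_all add: a_def b_def)
  have "\<lfloor>real k * (sqrt 2 - 1)\<rfloor> = int n \<longleftrightarrow> k \<in> {a<..b}" for k :: nat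
  proof -
    \<comment> \<open>This allows \<open>\<le>\<close> and \<open><\<close> to be exchanged at both
      ends. For \<open>n = 0\<close> it fails at \<open>k = 0\<close>, which \<open>A\<close> counts
      but \<open>{a<..b}\<close> omits.\<close>
    have "real n * ?s \<noteq> real k" "(real n + 1) * ?s \<noteq> real k"
      using mult_sqrt2_plus_1_neq_of_nat[of n k] mult_sqrt2_plus_1_neq_of_nat[of "Suc n" k] assms
      by (simp_all add: add.commute)
    moreover have "a < k \<longleftrightarrow> real n * ?s < real k"
      using floor_less_iff[of "real n * ?s" "int k"] by (simp flip: a)
    moreover have "k \<le> b \<longleftrightarrow> real k \<le> (real n + 1) * ?s"
      using le_floor_iff[of "int k" "(real n + 1) * ?s"] by (simp flip: b)
    ultimately show ?thesis
      unfolding floor_mult_sqrt2_minus_1_eq_iff by auto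
  qed
  then have "{k::nat. \<lfloor>real k * (sqrt 2 - 1)\<rfloor> = int n} = {a<..b}" by blast
  then have "A n = b - a" by (simp add: A_def)
  \<comment> \<open>The cardinality \<open>b - a\<close> is a truncated difference; this makes it
    agree with the integer difference in \<open>B\<close>.\<close>
  moreover have "int a \<le> int b" unfolding a b by (intro floor_mono mult_right_mono) auto
  ultimately show ?thesis unfolding B_def by (simp add: of_nat_diff flip: a b)
qed

end
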